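(* Let $P$ be the one-way infinite path (infinite ray), with vertex set $\mathbf{N}=\{0,1,2,3,\dots\}$ and edge set $E=\{\{j,j+1\}: j\in\mathbf{N}\}$. Then all vertices of $P$ are cyclic.
   Context: The adjacency operator $A$ of $P$ is the bounded self-adjoint operator on the complex Hilbert space $\ell^2(\mathbf{N})$ given by $(A\xi)(v)=\sum_{w:\{v,w\}\in E}\xi(w)$. For a vertex $v$, $\delta_v\in\ell^2(\mathbf{N})$ is the characteristic function of $\{v\}$. A vertex $v$ is cyclic if the closed linear span of $\{A^n\delta_v : n\ge 0\}$ is all of $\ell^2(\mathbf{N})$. *)

theory Defs
  imports "HOL-Analysis.Analysis"
begin

subsection \<open>The complex Hilbert space of square-summable sequences\<close>

definition square_summable :: "(nat \<Rightarrow> complex) \<Rightarrow> bool" where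
  "square_summable x \<longleftrightarrow> summable (\<lambda>n. (cmod (x n))\<^sup>2)"

lemma cmod_add_square_le: "(cmod (a + b))\<^sup>2 \<le> 2 * (cmod a)\<^sup>2 + 2 * (cmod b)\<^sup>2"
proof -
  have "(cmod (a + b))\<^sup>2 \<le> (cmod a + cmod b)\<^sup>2"
    by (intro power_mono norm_triangle_ineq norm_ge_zero)
  also have "\<dots> \<le> 2 * (cmod a)\<^sup>2 + 2 * (cmod b)\<^sup>2"
    using sum_squares_ge_zero[of "cmod a - cmod b" 0] by (simp add: power2_eq_square algebra_simps)
  finally show ?thesis .
qed

lemma square_summable_0: "square_summable (\<lambda>_. 0)"
  by (simp add: square_summable_def)

lemma square_summable_add:
  assumes "square_summable x" "square_summable y"
  shows "square_summable (\<lambda>n. x n + y n)"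
  unfolding square_summable_def
proof (rule summable_comparison_test')
  show "summable (\<lambda>n. 2 * (cmod (x n))\<^sup>2 + 2 * (cmod (y n))\<^sup>2)"
    using assms unfolding square_summable_def by (intro summable_add summable_mult)
qed (simp add: cmod_add_square_le)

lemma square_summable_scale: "square_summable x \<Longrightarrow> square_summable (\<lambda>n. c * x n)"
  unfolding square_summable_def by (simp add: norm_mult power_mult_distrib summable_mult)

lemma square_summable_scaleR: "square_summable x \<Longrightarrow> square_summable (\<lambda>n. r *\<^sub>R x n)"
  using square_summable_scale[of x "of_real r"] by (simp add: scaleR_conv_of_real)

lemma square_summable_uminus: "square_summable x \<Longrightarrow> square_summable (\<lambda>n. - x n)"
  by (simp add: square_summable_def)

lemma square_summable_diff:
  "square_summable x \<Longrightarrow> square_summable y \<Longrightarrow> square_summable (\<lambda>n. x n - y n)"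
  using square_summable_add[OF _ square_summable_uminus] by fastforce

lemma square_summable_delta: "square_summable (\<lambda>n. if n = v then 1 else 0)"
  unfolding square_summable_def
  by (rule summable_finite[of "{v}"]) auto

lemma summable_norm_cnj_mult:
  assumes "square_summable x" "square_summable y"
  shows "summable (\<lambda>n. norm (cnj (x n) * y n))"
proof (rule summable_comparison_test')
  show "summable (\<lambda>n. (cmod (x n))\<^sup>2 + (cmod (y n))\<^sup>2)"
    using assms unfolding square_summable_def by (intro summable_add)
  show "norm (norm (cnj (x n) * y n)) \<le> (cmod (x n))\<^sup>2 + (cmod (y n))\<^sup>2" for n
  proof -
    have "2 * (cmod (x n) * cmod (y n)) \<le> (cmod (x n))\<^sup>2 + (cmod (y n))\<^sup>2"
      using zero_le_power2[of "cmod (x n) - cmod (y n)"] by (simp add: power2_diff)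
    moreover have "0 \<le> cmod (x n) * cmod (y n)"
      by simp
    ultimately have "cmod (x n) * cmod (y n) \<le> (cmod (x n))\<^sup>2 + (cmod (y n))\<^sup>2"
      by linarith
    then show ?thesis
      by (simp add: norm_mult)
  qed
qed

lemma summable_cnj_mult:
  "square_summable x \<Longrightarrow> square_summable y \<Longrightarrow> summable (\<lambda>n. cnj (x n) * y n)"
  by (rule summable_norm_cancel[OF summable_norm_cnj_mult])

typedef ell2 = "{x. square_summable x}"
  morphisms ell2_apply Abs_ell2
  using square_summable_0 by auto

setup_lifting type_definition_ell2

lemma square_summable_ell2_apply: "square_summable (ell2_apply x)"
  using ell2_apply by simp

lift_definition scaleC_ell2 :: "complex \<Rightarrow> ell2 \<Rightarrow> ell2" (infixr "*\<^sub>C" 75)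
  is "\<lambda>c x n. c * x n"
  by (rule square_summable_scale)

lift_definition cinner_ell2 :: "ell2 \<Rightarrow> ell2 \<Rightarrow> complex"
  is "\<lambda>x y. \<Sum>n. cnj (x n) * y n" .

text \<open>
  The distribution has no class of complex inner product spaces, so the topology is obtained from
  the underlying real inner product space, whose inner product is the real part of
  \<^const>\<open>cinner_ell2\<close> and whose norm is therefore the usual one.
\<close>

instantiation ell2 :: real_inner
begin

lift_definition zero_ell2 :: ell2 is "\<lambda>_. 0"
  by (rule square_summable_0)

lift_definition plus_ell2 :: "ell2 \<Rightarrow> ell2 \<Rightarrow> ell2" is "\<lambda>x y n. x n + y n"
  by (rule square_summable_add)

lift_definition minus_ell2 :: "ell2 \<Rightarrow> ell2 \<Rightarrow> ell2" is "\<lambda>x y n. x n - y n"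
  by (rule square_summable_diff)

lift_definition uminus_ell2 :: "ell2 \<Rightarrow> ell2" is "\<lambda>x n. - x n"
  by (rule square_summable_uminus)

lift_definition scaleR_ell2 :: "real \<Rightarrow> ell2 \<Rightarrow> ell2" is "\<lambda>r x n. r *\<^sub>R x n"
  by (rule square_summable_scaleR)

definition inner_ell2 :: "ell2 \<Rightarrow> ell2 \<Rightarrow> real" where
  "inner_ell2 x y = Re (cinner_ell2 x y)"

lift_definition norm_ell2 :: "ell2 \<Rightarrow> real" is "\<lambda>x. sqrt (\<Sum>n. (cmod (x n))\<^sup>2)" .

definition dist_ell2 :: "ell2 \<Rightarrow> ell2 \<Rightarrow> real" where
  "dist_ell2 x y = norm (x - y)"

definition sgn_ell2 :: "ell2 \<Rightarrow> ell2" where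
  "sgn_ell2 x = inverse (norm x) *\<^sub>R x"

definition uniformity_ell2 :: "(ell2 \<times> ell2) filter" where
  "uniformity_ell2 = (INF e\<in>{0<..}. principal {(x, y). dist x y < e})"

definition open_ell2 :: "ell2 set \<Rightarrow> bool" where
  "open_ell2 U \<longleftrightarrow> (\<forall>x\<in>U. eventually (\<lambda>(x', y). x' = x \<longrightarrow> y \<in> U) uniformity)"

instance
proof
  fix x y z :: ell2 and r s :: real and U :: "ell2 set"
  show "x + y + z = x + (y + z)" "x + y = y + x" "0 + x = x" "- x + x = 0" "x - y = x + - y"
    by (transfer; simp add: algebra_simps)+
  show "r *\<^sub>R (x + y) = r *\<^sub>R x + r *\<^sub>R y" "(r + s) *\<^sub>R x = r *\<^sub>R x + s *\<^sub>R x"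
    "r *\<^sub>R s *\<^sub>R x = (r * s) *\<^sub>R x" "1 *\<^sub>R x = x"
    by (transfer; simp add: algebra_simps)+
  show "dist x y = norm (x - y)" "sgn x = inverse (norm x) *\<^sub>R x"
    "(uniformity :: (ell2 \<times> ell2) filter) = (INF e\<in>{0<..}. principal {(x, y). dist x y < e})"
    "open U \<longleftrightarrow> (\<forall>x\<in>U. eventually (\<lambda>(x', y). x' = x \<longrightarrow> y \<in> U) uniformity)"
    by (simp_all add: dist_ell2_def sgn_ell2_def uniformity_ell2_def open_ell2_def)
  note S = summable_cnj_mult and sm = square_summable_ell2_apply
  have R: "Re (cinner_ell2 x y) = (\<Sum>n. Re (cnj (ell2_apply x n) * ell2_apply y n))" for x y
    unfolding cinner_ell2.rep_eq
    by (rule bounded_linear.suminf[OF bounded_linear_Re S[OF sm sm]])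
  have SR: "summable (\<lambda>n. Re (cnj (ell2_apply x n) * ell2_apply y n))" for x y
    by (rule bounded_linear.summable[OF bounded_linear_Re S[OF sm sm]])
  have N: "Re (cinner_ell2 x x) = (\<Sum>n. (cmod (ell2_apply x n))\<^sup>2)" for x
    unfolding R cmod_power2 by (simp add: power2_eq_square)
  have SN: "summable (\<lambda>n. (cmod (ell2_apply x n))\<^sup>2)" for x
    using sm[of x] by (simp add: square_summable_def)
  show "inner x y = inner y x"
    unfolding inner_ell2_def R by (simp add: mult.commute)
  show "inner (x + y) z = inner x z + inner y z"
    unfolding inner_ell2_def R suminf_add[OF SR SR]
    by (simp add: plus_ell2.rep_eq algebra_simps)
  show "inner (r *\<^sub>R x) y = r * inner x y"
    unfolding inner_ell2_def R suminf_mult[OF SR, symmetric]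
    by (simp add: scaleR_ell2.rep_eq algebra_simps)
  show "0 \<le> inner x x"
    unfolding inner_ell2_def N by (rule suminf_nonneg[OF SN]) simp
  show "inner x x = 0 \<longleftrightarrow> x = 0"
    unfolding inner_ell2_def N suminf_eq_zero_iff[OF SN zero_le_power2]
    by (simp add: ell2_apply_inject[symmetric] zero_ell2.rep_eq fun_eq_iff)
  show "norm x = sqrt (inner x x)"
    unfolding inner_ell2_def N norm_ell2.rep_eq ..
qed

end

interpretation ell2: vector_space scaleC_ell2
  by unfold_locales (transfer; simp add: algebra_simps)+

lift_definition ell2_delta :: "nat \<Rightarrow> ell2" is "\<lambda>v n. if n = v then 1 else 0"
  by (rule square_summable_delta)


subsection \<open>The one-way infinite path\<close>

definition path_edges :: "nat set set" where
  "path_edges = {{j, j + 1} | j. True}"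

lemma path_neighbours: "{w. {v, w} \<in> path_edges} = (if v = 0 then {1} else {v - 1, v + 1})"
  by (cases v) (auto simp: path_edges_def doubleton_eq_iff)

lemma sum_path_neighbours:
  "(\<Sum>w | {v, w} \<in> path_edges. f w) = (if v = 0 then 0 else f (v - 1)) + (f (v + 1) :: complex)"
  unfolding path_neighbours by simp

lemma square_summable_adjacency:
  assumes "square_summable x"
  shows "square_summable (\<lambda>v. \<Sum>w | {v, w} \<in> path_edges. x w)"
  unfolding sum_path_neighbours
proof (rule square_summable_add)
  show "square_summable (\<lambda>v. if v = 0 then 0 else x (v - 1))"
    using assms unfolding square_summable_def by (subst summable_Suc_iff[symmetric]) simp
  show "square_summable (\<lambda>v. x (v + 1))"
    using assms unfolding square_summable_def
    by (simp add: summable_Suc_iff[of "\<lambda>n. (cmod (x n))\<^sup>2"])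
qed

lift_definition path_adjacency :: "ell2 \<Rightarrow> ell2"
  is "\<lambda>\<xi> v. \<Sum>w | {v, w} \<in> path_edges. \<xi> w"
  by (rule square_summable_adjacency)

lemma path_adjacency_apply:
  "ell2_apply (path_adjacency \<xi>) v =
    (if v = 0 then 0 else ell2_apply \<xi> (v - 1)) + ell2_apply \<xi> (v + 1)"
  by (simp only: path_adjacency.rep_eq sum_path_neighbours)

lemma path_adjacency_add: "path_adjacency (x + y) = path_adjacency x + path_adjacency y"
  by (simp add: ell2_apply_inject[symmetric] fun_eq_iff path_adjacency_apply plus_ell2.rep_eq)

lemma path_adjacency_scaleC: "path_adjacency (c *\<^sub>C x) = c *\<^sub>C path_adjacency x"
  by (simp add: ell2_apply_inject[symmetric] fun_eq_iff path_adjacency_apply scaleC_ell2.rep_eq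
      algebra_simps)

lemma norm_path_adjacency_le: "norm (path_adjacency x) \<le> 2 * norm x"
proof -
  let ?x = "ell2_apply x"
  have S: "summable (\<lambda>n. (cmod (?x n))\<^sup>2)"
    using square_summable_ell2_apply[of x] by (simp add: square_summable_def)
  let ?l = "\<lambda>v. (cmod (if v = 0 then 0 else ?x (v - 1)))\<^sup>2"
  have Sl: "summable ?l"
    using S by (subst summable_Suc_iff[symmetric]) simp
  have Sr: "summable (\<lambda>v. (cmod (?x (v + 1)))\<^sup>2)"
    using S by (simp add: summable_Suc_iff[of "\<lambda>n. (cmod (?x n))\<^sup>2"])
  have l: "(\<Sum>v. ?l v) = (\<Sum>n. (cmod (?x n))\<^sup>2)"
    using suminf_split_head[OF Sl] by simp
  have r: "(\<Sum>v. (cmod (?x (v + 1)))\<^sup>2) \<le> (\<Sum>n. (cmod (?x n))\<^sup>2)"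
    using suminf_split_head[OF S] by simp
  have SA: "summable (\<lambda>v. (cmod (ell2_apply (path_adjacency x) v))\<^sup>2)"
    using square_summable_ell2_apply[of "path_adjacency x"] by (simp add: square_summable_def)
  have "(\<Sum>v. (cmod (ell2_apply (path_adjacency x) v))\<^sup>2)
      \<le> (\<Sum>v. 2 * ?l v + 2 * (cmod (?x (v + 1)))\<^sup>2)"
    unfolding path_adjacency_apply
    by (intro suminf_le cmod_add_square_le SA[unfolded path_adjacency_apply]
        summable_add summable_mult Sl Sr)
  also have "\<dots> = 2 * (\<Sum>v. ?l v) + 2 * (\<Sum>v. (cmod (?x (v + 1)))\<^sup>2)"
    by (simp only: suminf_add[OF summable_mult[OF Sl] summable_mult[OF Sr], symmetric]
        suminf_mult[OF Sl] suminf_mult[OF Sr])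
  also have "\<dots> \<le> 2\<^sup>2 * (\<Sum>n. (cmod (?x n))\<^sup>2)"
    using l r by simp
  finally have "norm (path_adjacency x) \<le> sqrt (2\<^sup>2 * (\<Sum>n. (cmod (?x n))\<^sup>2))"
    unfolding norm_ell2.rep_eq by (rule real_sqrt_le_mono)
  then show ?thesis
    by (simp only: norm_ell2.rep_eq real_sqrt_mult real_sqrt_abs abs_numeral)
qed

lemma path_adjacency_selfadjoint:
  "cinner_ell2 (path_adjacency x) y = cinner_ell2 x (path_adjacency y)"
proof -
  let ?x = "ell2_apply x" and ?y = "ell2_apply y"
  let ?down = "\<lambda>f v. if v = 0 then 0 else f (v - 1 :: nat) :: complex"
  let ?up = "\<lambda>f v. f (v + 1 :: nat) :: complex"
  have sd: "square_summable (?down (ell2_apply z))" for z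
    using square_summable_ell2_apply[of z] unfolding square_summable_def
    by (subst summable_Suc_iff[symmetric]) simp
  have su: "square_summable (?up (ell2_apply z))" for z
    using square_summable_ell2_apply[of z] unfolding square_summable_def
    by (simp add: summable_Suc_iff[of "\<lambda>n. (cmod (ell2_apply z n))\<^sup>2"])
  note s = square_summable_ell2_apply
  have shift1: "(\<Sum>v. cnj (?down ?x v) * ?y v) = (\<Sum>v. cnj (?x v) * ?up ?y v)"
    using suminf_split_head[OF summable_cnj_mult[OF sd s, of x y]] by simp
  have shift2: "(\<Sum>v. cnj (?up ?x v) * ?y v) = (\<Sum>v. cnj (?x v) * ?down ?y v)"
    using suminf_split_head[OF summable_cnj_mult[OF s sd, of x y]] by simp
  have "cinner_ell2 (path_adjacency x) y
      = (\<Sum>v. cnj (?down ?x v) * ?y v + cnj (?up ?x v) * ?y v)"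
    unfolding cinner_ell2.rep_eq path_adjacency_apply by (simp only: complex_cnj_add distrib_right)
  also have "\<dots> = (\<Sum>v. cnj (?x v) * ?down ?y v) + (\<Sum>v. cnj (?x v) * ?up ?y v)"
    unfolding suminf_add[OF summable_cnj_mult[OF sd s] summable_cnj_mult[OF su s], symmetric]
      shift1 shift2 by (rule add.commute)
  also have "\<dots> = cinner_ell2 x (path_adjacency y)"
    unfolding cinner_ell2.rep_eq path_adjacency_apply
      suminf_add[OF summable_cnj_mult[OF s sd] summable_cnj_mult[OF s su]]
    by (simp only: distrib_left)
  finally show ?thesis .
qed

definition cyclic_vertex :: "nat \<Rightarrow> bool" where
  "cyclic_vertex v \<longleftrightarrow>
    closure (ell2.span {(path_adjacency ^^ n) (ell2_delta v) | n. True}) = UNIV"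

end

theory Submission
  imports Defs "HOL-Computational_Algebra.Fundamental_Theorem_Algebra"
begin

text \<open>
  Let \<open>U\<^sub>n\<close> be the (rescaled) Chebyshev polynomials of the second kind, so that
  \<open>U\<^sub>n(A) \<delta>\<^sub>0 = \<delta>\<^sub>n\<close>.  Thus \<open>\<delta>\<^sub>0\<close> is cyclic, and it suffices to approximate \<open>\<delta>\<^sub>0\<close> by vectors
  \<open>q(A) U\<^sub>v(A) \<delta>\<^sub>0\<close>.  Splitting \<open>U\<^sub>v\<close> into linear factors over the complex numbers reduces this
  to approximating \<open>\<delta>\<^sub>0\<close> by vectors \<open>q(A) (A - \<lambda>) \<delta>\<^sub>0\<close>.  Put \<open>u\<^sub>k = U\<^sub>k(\<lambda>)\<close> and
  \<open>s = \<Sum>\<^sub>k\<^sub><\<^sub>N \<bar>u\<^sub>k\<bar>\<^sup>2\<close>.  The polynomial \<open>1 - s\<^sup>-\<^sup>1 \<Sum>\<^sub>k\<^sub><\<^sub>N cnj(u\<^sub>k) U\<^sub>k\<close> vanishes at \<open>\<lambda>\<close>, and applied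
  to \<open>A\<close> it sends \<open>\<delta>\<^sub>0\<close> to a vector at distance \<open>s\<^sup>-\<^sup>1\<^sup>/\<^sup>2\<close> from \<open>\<delta>\<^sub>0\<close>.  Finally \<open>s\<close> is unbounded as
  \<open>N\<close> grows, because the invariant \<open>u\<^sub>k\<^sub>+\<^sub>1\<^sup>2 - \<lambda> u\<^sub>k\<^sub>+\<^sub>1 u\<^sub>k + u\<^sub>k\<^sup>2 = 1\<close> prevents \<open>u\<^sub>k\<close> from tending
  to \<open>0\<close>.
\<close>

section \<open>Norms, bounded operators and finite truncations in \<open>ell2\<close>\<close>

lemma ell2_eqI: "(\<And>n. ell2_apply x n = ell2_apply y n) \<Longrightarrow> x = y"
  by (simp add: ell2_apply_inject[symmetric] fun_eq_iff)

lemma ell2_apply_sum: "ell2_apply (sum f I) n = (\<Sum>i\<in>I. ell2_apply (f i) n)"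
  by (induction I rule: infinite_finite_induct) (simp_all add: zero_ell2.rep_eq plus_ell2.rep_eq)

lemma norm_ell2_power2: "(norm x)\<^sup>2 = (\<Sum>n. (cmod (ell2_apply x n))\<^sup>2)"
  using square_summable_ell2_apply[of x]
  by (simp add: norm_ell2.rep_eq square_summable_def suminf_nonneg)

lemma scaleR_eq_scaleC: "r *\<^sub>R (x :: ell2) = complex_of_real r *\<^sub>C x"
  by (rule ell2_eqI) (simp add: scaleR_ell2.rep_eq scaleC_ell2.rep_eq scaleR_conv_of_real)

lemma norm_scaleC: "norm (c *\<^sub>C x) = cmod c * norm x"
proof -
  have "summable (\<lambda>n. (cmod (ell2_apply x n))\<^sup>2)"
    using square_summable_ell2_apply[of x] by (simp add: square_summable_def)
  then show ?thesis
    by (simp add: norm_ell2.rep_eq scaleC_ell2.rep_eq norm_mult power_mult_distrib suminf_mult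
        real_sqrt_mult)
qed

lemma bounded_linear_scaleC: "bounded_linear (\<lambda>x. c *\<^sub>C x)"
  by (rule bounded_linear_intro[where K = "cmod c"])
    (simp_all add: ell2.scale_right_distrib scaleR_eq_scaleC norm_scaleC mult.commute)

lemma bounded_linear_path_adjacency: "bounded_linear path_adjacency"
  by (rule bounded_linear_intro[where K = 2])
    (use norm_path_adjacency_le in \<open>simp_all add: path_adjacency_add scaleR_eq_scaleC
      path_adjacency_scaleC mult.commute\<close>)

definition ell2_truncate :: "ell2 \<Rightarrow> nat \<Rightarrow> ell2" where
  "ell2_truncate x N = (\<Sum>k<N. ell2_apply x k *\<^sub>C ell2_delta k)"

lemma ell2_apply_sum_delta:
  "ell2_apply (\<Sum>k<N. c k *\<^sub>C ell2_delta k) n = (if n < N then c n else 0)"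
proof -
  have "ell2_apply (\<Sum>k<N. c k *\<^sub>C ell2_delta k) n = (\<Sum>k<N. if n = k then c k else 0)"
    unfolding ell2_apply_sum
    by (rule sum.cong) (simp_all add: scaleC_ell2.rep_eq ell2_delta.rep_eq)
  then show ?thesis
    by simp
qed

lemma norm_sum_delta: "(norm (\<Sum>k<N. c k *\<^sub>C ell2_delta k))\<^sup>2 = (\<Sum>k<N. (cmod (c k))\<^sup>2)"
  unfolding norm_ell2_power2 ell2_apply_sum_delta
  by (subst suminf_finite[of "{..<N}"]) simp_all

text \<open>The squared error is a tail of the convergent series of squared moduli.\<close>

lemma ell2_truncate_tendsto: "(\<lambda>N. ell2_truncate x N) \<longlonglongrightarrow> x"
proof -
  let ?f = "\<lambda>n. (cmod (ell2_apply x n))\<^sup>2"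
  have S: "summable ?f"
    using square_summable_ell2_apply[of x] by (simp add: square_summable_def)
  have eq: "(norm (ell2_truncate x N - x))\<^sup>2 = suminf ?f - sum ?f {..<N}" for N
  proof -
    have "(norm (ell2_truncate x N - x))\<^sup>2 = (\<Sum>n. if n < N then 0 else ?f n)"
      unfolding norm_ell2_power2
      by (rule suminf_cong)
        (simp add: minus_ell2.rep_eq ell2_truncate_def ell2_apply_sum_delta)
    also have "\<dots> = (\<Sum>n. ?f n - (if n < N then ?f n else 0))"
      by (rule suminf_cong) simp
    also have "\<dots> = suminf ?f - (\<Sum>n. if n < N then ?f n else 0)"
      by (rule suminf_diff[symmetric, OF S]) (rule summable_finite[of "{..<N}"], simp_all)
    also have "(\<Sum>n. if n < N then ?f n else 0) = sum ?f {..<N}"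
      by (subst suminf_finite[of "{..<N}"]) simp_all
    finally show ?thesis .
  qed
  have "(\<lambda>N. suminf ?f - sum ?f {..<N}) \<longlonglongrightarrow> suminf ?f - suminf ?f"
    by (intro tendsto_intros summable_LIMSEQ S)
  then have "(\<lambda>N. sqrt ((norm (ell2_truncate x N - x))\<^sup>2)) \<longlonglongrightarrow> sqrt 0"
    unfolding eq by (intro tendsto_real_sqrt) simp
  then show ?thesis
    by (simp add: tendsto_norm_zero_iff LIM_zero_iff)
qed


subsection \<open>Polynomials in the adjacency operator\<close>

text \<open>Horner's scheme, so that proofs can recurse along \<open>pCons\<close>.\<close>

definition poly_adjacency :: "complex poly \<Rightarrow> ell2 \<Rightarrow> ell2" where
  "poly_adjacency p = fold_coeffs (\<lambda>a f x. a *\<^sub>C x + path_adjacency (f x)) p (\<lambda>x. 0)"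

lemma poly_adjacency_0 [simp]: "poly_adjacency 0 x = 0"
  by (simp add: poly_adjacency_def)

lemma poly_adjacency_pCons [simp]:
  "poly_adjacency (pCons a p) x = a *\<^sub>C x + path_adjacency (poly_adjacency p x)"
  \<comment> \<open>The fold sees no coefficient in \<open>pCons 0 0 = 0\<close>; that case rests on
    \<open>path_adjacency 0 = 0\<close>.\<close>
  using linear_0[OF bounded_linear.linear[OF bounded_linear_path_adjacency]]
  by (cases "a = 0 \<and> p = 0") (auto simp: poly_adjacency_def)

lemma poly_adjacency_add:
  "poly_adjacency (p + q) x = poly_adjacency p x + poly_adjacency q x"
  by (induction p q rule: poly_induct2)
    (simp_all add: path_adjacency_add ell2.scale_left_distrib)

lemma poly_adjacency_smult: "poly_adjacency (smult c p) x = c *\<^sub>C poly_adjacency p x"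
  by (induction p)
    (simp_all add: path_adjacency_scaleC ell2.scale_right_distrib)

lemma poly_adjacency_diff:
  "poly_adjacency (p - q) x = poly_adjacency p x - poly_adjacency q x"
  using poly_adjacency_add[of "p - q" q x] by simp

lemma poly_adjacency_sum:
  "poly_adjacency (sum f I) x = (\<Sum>i\<in>I. poly_adjacency (f i) x)"
  by (induction I rule: infinite_finite_induct) (simp_all add: poly_adjacency_add)

lemma poly_adjacency_mult:
  "poly_adjacency (p * q) x = poly_adjacency p (poly_adjacency q x)"
  by (induction p) (simp_all add: poly_adjacency_add poly_adjacency_smult)

lemma poly_adjacency_1: "poly_adjacency 1 x = x"
  using linear_0[OF bounded_linear.linear[OF bounded_linear_path_adjacency]]
  by (simp add: one_pCons)

lemma bounded_linear_poly_adjacency: "bounded_linear (poly_adjacency p)"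
proof (induction p)
  case 0
  then show ?case
    using bounded_linear_zero by (simp add: poly_adjacency_def)
next
  case (pCons a p)
  have "bounded_linear (\<lambda>x. a *\<^sub>C x + path_adjacency (poly_adjacency p x))"
    by (intro bounded_linear_add bounded_linear_scaleC
        bounded_linear_compose[OF bounded_linear_path_adjacency] pCons.IH)
  then show ?case
    by (simp flip: poly_adjacency_pCons)
qed

lemma poly_adjacency_closure:
  assumes "x \<in> closure S"
  shows "poly_adjacency p x \<in> closure (poly_adjacency p ` S)"
  using closure_bounded_linear_image_subset[OF bounded_linear_poly_adjacency, of p S] assms
  by blast

lemma poly_adjacency_in_span:
  "poly_adjacency p x \<in> ell2.span {(path_adjacency ^^ n) x | n. True}" (is "_ \<in> ?S")
proof (induction p)
  case 0
  then show ?case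
    by (simp add: ell2.span_zero)
next
  case (pCons a p)
  \<comment> \<open>The span is stable under the operator, since each generator is sent to the next
    one.\<close>
  have "path_adjacency y \<in> ?S" if "y \<in> ?S" for y
    using that
  proof (induction rule: ell2.span_induct_alt)
    case base
    then show ?case
      using linear_0[OF bounded_linear.linear[OF bounded_linear_path_adjacency]]
      by (simp add: ell2.span_zero)
  next
    case (step c z y)
    then obtain n where "z = (path_adjacency ^^ n) x"
      by blast
    then have "path_adjacency z = (path_adjacency ^^ Suc n) x"
      by simp
    then have "path_adjacency z \<in> ?S"
      by (metis (mono_tags, lifting) ell2.span_base mem_Collect_eq)
    then show ?case
      using step by (simp add: path_adjacency_add path_adjacency_scaleC ell2.span_add
          ell2.span_scale)
  qed
  moreover have "x \<in> ?S"
    by (rule ell2.span_base) (auto intro: exI[of _ 0])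
  ultimately show ?case
    using pCons.IH by (simp add: ell2.span_add ell2.span_scale)
qed


subsection \<open>Chebyshev polynomials\<close>

text \<open>\<open>path_poly n\<close> is the Chebyshev polynomial of the second kind evaluated at \<open>x / 2\<close>.\<close>

fun path_poly :: "nat \<Rightarrow> complex poly" where
  "path_poly 0 = 1"
| "path_poly (Suc 0) = [:0, 1:]"
| "path_poly (Suc (Suc n)) = pCons 0 (path_poly (Suc n)) - path_poly n"

lemma path_adjacency_delta_0: "path_adjacency (ell2_delta 0) = ell2_delta 1"
  by (rule ell2_eqI) (auto simp: path_adjacency_apply ell2_delta.rep_eq)

lemma path_adjacency_delta_Suc:
  "path_adjacency (ell2_delta (Suc n)) = ell2_delta n + ell2_delta (Suc (Suc n))"
  by (rule ell2_eqI) (auto simp: path_adjacency_apply ell2_delta.rep_eq plus_ell2.rep_eq)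

lemma path_poly_delta: "poly_adjacency (path_poly n) (ell2_delta 0) = ell2_delta n"
  by (induction n rule: path_poly.induct)
    (simp_all add: poly_adjacency_1 path_adjacency_delta_0 path_adjacency_delta_Suc
      poly_adjacency_diff flip: one_pCons)

lemma path_poly_sum_delta:
  "poly_adjacency (\<Sum>k\<in>I. smult (c k) (path_poly k)) (ell2_delta 0) =
    (\<Sum>k\<in>I. c k *\<^sub>C ell2_delta k)"
  by (simp add: poly_adjacency_sum poly_adjacency_smult path_poly_delta)

lemma path_poly_nonzero: "path_poly n \<noteq> 0"
proof
  assume "path_poly n = 0"
  then have "ell2_delta n = 0"
    using path_poly_delta[of n] by simp
  then have "ell2_apply (ell2_delta n) n = 0"
    by (simp add: zero_ell2.rep_eq)
  then show False
    by (simp add: ell2_delta.rep_eq)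
qed

text \<open>Write \<open>u k\<close> for \<open>poly (path_poly k) z\<close>. If \<open>u n\<close>
  is a root \<open>t\<close> of \<open>t^2 - z * u (n + 1) * t + u (n + 1)^2 = 1\<close>, the other
  root is \<open>z * u (n + 1) - u n = u (n + 2)\<close>, which carries the relation from
  \<open>n\<close> to \<open>n + 1\<close>.\<close>

lemma path_poly_invariant:
  "(poly (path_poly (Suc n)) z)\<^sup>2 - z * poly (path_poly (Suc n)) z * poly (path_poly n) z
    + (poly (path_poly n) z)\<^sup>2 = 1"
  by (induction n) (simp_all add: power2_eq_square algebra_simps)

lemma path_poly_not_square_summable: "\<not> square_summable (\<lambda>n. poly (path_poly n) z)"
proof
  let ?u = "\<lambda>n. poly (path_poly n) z"
  assume "square_summable ?u"
  then have "(\<lambda>n. sqrt ((cmod (?u n))\<^sup>2)) \<longlonglongrightarrow> sqrt 0"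
    unfolding square_summable_def by (intro tendsto_real_sqrt summable_LIMSEQ_zero)
  then have u: "?u \<longlonglongrightarrow> 0"
    by (simp add: tendsto_norm_zero_iff)
  then have "(\<lambda>n. (?u (Suc n))\<^sup>2 - z * ?u (Suc n) * ?u n + (?u n)\<^sup>2) \<longlonglongrightarrow> 0\<^sup>2 - z * 0 * 0 + 0\<^sup>2"
    by (intro tendsto_intros LIMSEQ_Suc)
  then have "(\<lambda>n. 1 :: complex) \<longlonglongrightarrow> 0"
    unfolding path_poly_invariant by simp
  then show False
    by (simp add: LIMSEQ_const_iff)
qed


subsection \<open>Cyclicity\<close>

lemma delta_0_linear_factor:
  "ell2_delta 0 \<in> closure (range (\<lambda>q. poly_adjacency (q * [:-z, 1:]) (ell2_delta 0)))"
proof (unfold closure_approachable, intro allI impI)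
  fix e :: real assume e: "e > 0"
  let ?u = "\<lambda>n. poly (path_poly n) z"
  \<comment> \<open>This threshold makes the final error \<open>1 / sqrt s\<close> smaller than
    \<open>e\<close>.\<close>
  obtain N where N: "(\<Sum>k<N. (cmod (?u k))\<^sup>2) > 1 / e\<^sup>2"
  proof (rule ccontr)
    assume "\<not> thesis"
    then have "(\<Sum>k<N. (cmod (?u k))\<^sup>2) \<le> 1 / e\<^sup>2" for N
      using that[of N] by linarith
    then have "summable (\<lambda>k. (cmod (?u k))\<^sup>2)"
      by (intro summableI_nonneg_bounded) simp_all
    then show False
      using path_poly_not_square_summable by (simp add: square_summable_def)
  qed
  define s where "s = (\<Sum>k<N. (cmod (?u k))\<^sup>2)"
  have "0 < 1 / e\<^sup>2"
    using e by simp
  with N have s: "s > 1 / e\<^sup>2" "s > 0"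
    unfolding s_def by linarith+
  \<comment> \<open>The conjugate weights turn \<open>poly r z\<close> into \<open>s\<close>, so
    that \<open>1 - r / s\<close> has the root \<open>z\<close>.\<close>
  define r where "r = (\<Sum>k<N. smult (cnj (?u k)) (path_poly k))"
  define w where "w = (\<Sum>k<N. cnj (?u k) *\<^sub>C ell2_delta k)"
  have "poly r z = of_real s"
    unfolding r_def s_def of_real_sum
    by (simp add: poly_sum complex_norm_square mult.commute del: of_real_power)
  then have "poly (1 - smult (of_real (1 / s)) r) z = 0"
    using s by simp
  then obtain q where q: "1 - smult (of_real (1 / s)) r = q * [:-z, 1:]"
    by (metis poly_eq_0_iff_dvd dvdE mult.commute)
  have "poly_adjacency (q * [:-z, 1:]) (ell2_delta 0) = ell2_delta 0 - of_real (1 / s) *\<^sub>C w"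
    unfolding q[symmetric] poly_adjacency_diff poly_adjacency_smult poly_adjacency_1 r_def w_def
      path_poly_sum_delta ..
  then have "dist (poly_adjacency (q * [:-z, 1:]) (ell2_delta 0)) (ell2_delta 0) = norm w / s"
    using s by (simp add: dist_norm norm_scaleC norm_divide)
  also have "\<dots> < e"
  proof -
    have w: "(norm w)\<^sup>2 = s"
      unfolding w_def norm_sum_delta by (simp add: s_def)
    have "(norm w / s)\<^sup>2 = 1 / s"
      using s unfolding power_divide w by (simp add: power2_eq_square)
    also have "\<dots> < e\<^sup>2"
      using s e by (simp add: field_simps)
    finally show ?thesis
      using e by (simp add: power2_less_imp_less)
  qed
  finally show "\<exists>y\<in>range (\<lambda>q. poly_adjacency (q * [:-z, 1:]) (ell2_delta 0)).
      dist y (ell2_delta 0) < e"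
    by blast
qed

text \<open>Induction on the degree splits off a root: \<open>p = [:-z, 1:] * r\<close>. The
  continuous operator given by \<open>q * r\<close> carries the approximants of
  \<open>ell2_delta 0\<close> from the linear case to vectors given by multiples of
  \<open>p\<close>, so the closure for \<open>p\<close> contains the one for
  \<open>r\<close>.\<close>

lemma delta_0_poly_multiple:
  assumes "p \<noteq> 0"
  shows "ell2_delta 0 \<in> closure (range (\<lambda>q. poly_adjacency (q * p) (ell2_delta 0)))"
  using assms
proof (induction "degree p" arbitrary: p)
  case 0
  then obtain c where c: "p = [:c:]" "c \<noteq> 0"
    by (metis degree_eq_zeroE pCons_0_0)
  then have "poly_adjacency ([:1 / c:] * p) (ell2_delta 0) = ell2_delta 0"
    using poly_adjacency_1 by (simp flip: one_pCons)
  then show ?case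
    by (metis (no_types, lifting) closure_subset rangeI subset_eq)
next
  case (Suc d)
  have "\<not> constant (poly p)"
    using Suc.hyps(2) by (simp add: constant_degree)
  then obtain z where "poly p z = 0"
    using fundamental_theorem_of_algebra by blast
  then obtain r where r: "p = [:-z, 1:] * r"
    by (auto simp: poly_eq_0_iff_dvd)
  have r0: "r \<noteq> 0"
    using r Suc.prems by auto
  then have "degree p = 1 + degree r"
    unfolding r by (subst degree_mult_eq) auto
  then have IH: "ell2_delta 0 \<in> closure (range (\<lambda>q. poly_adjacency (q * r) (ell2_delta 0)))"
    using Suc r0 by simp
  have "poly_adjacency (q * r) (ell2_delta 0)
      \<in> closure (range (\<lambda>q. poly_adjacency (q * p) (ell2_delta 0)))" for q
  proof -
    have "poly_adjacency (q * r) ` range (\<lambda>t. poly_adjacency (t * [:-z, 1:]) (ell2_delta 0))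
        \<subseteq> range (\<lambda>q. poly_adjacency (q * p) (ell2_delta 0))"
    proof clarify
      fix t
      have "q * r * (t * [:-z, 1:]) = q * t * p"
        unfolding r by (simp only: mult_ac)
      then show "poly_adjacency (q * r) (poly_adjacency (t * [:-z, 1:]) (ell2_delta 0))
          \<in> range (\<lambda>q. poly_adjacency (q * p) (ell2_delta 0))"
        unfolding poly_adjacency_mult[symmetric] by (metis rangeI)
    qed
    then show ?thesis
      using poly_adjacency_closure[OF delta_0_linear_factor] closure_mono by blast
  qed
  then have "closure (range (\<lambda>q. poly_adjacency (q * r) (ell2_delta 0)))
      \<subseteq> closure (range (\<lambda>q. poly_adjacency (q * p) (ell2_delta 0)))"
    by (intro closure_minimal) auto
  with IH show ?case
    by blast
qed

theorem proposition7p1: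
  "\<forall>v::nat. cyclic_vertex v"
proof
  fix v
  let ?S = "ell2.span {(path_adjacency ^^ n) (ell2_delta v) | n. True}"
  have delta_0: "ell2_delta 0 \<in> closure (range (\<lambda>q. poly_adjacency q (ell2_delta v)))"
    \<comment> \<open>Multiples of \<open>path_poly v\<close> acting on \<open>ell2_delta 0\<close>
      are arbitrary polynomials acting on \<open>ell2_delta v\<close>.\<close>
    using delta_0_poly_multiple[OF path_poly_nonzero, of v]
    by (simp add: poly_adjacency_mult path_poly_delta)
  have "ell2_truncate x N \<in> closure ?S" for x N
  proof -
    \<comment> \<open>This polynomial sends \<open>ell2_delta 0\<close> to the truncation of
      \<open>x\<close>.\<close>
    define p where "p = (\<Sum>k<N. smult (ell2_apply x k) (path_poly k))"
    have "poly_adjacency p ` range (\<lambda>q. poly_adjacency q (ell2_delta v)) \<subseteq> ?S"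
      using poly_adjacency_in_span by (auto simp flip: poly_adjacency_mult)
    then have "poly_adjacency p (ell2_delta 0) \<in> closure ?S"
      using poly_adjacency_closure[OF delta_0] closure_mono by blast
    then show ?thesis
      unfolding p_def path_poly_sum_delta ell2_truncate_def .
  qed
  then have "x \<in> closure ?S" for x
    by (rule closed_sequentially[OF closed_closure _ ell2_truncate_tendsto])
  then show "cyclic_vertex v"
    unfolding cyclic_vertex_def by blast
qed

end
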